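(* Let $X$ be a compact metric space, $T:X\to X$ a measurable map, $\varphi:X\to\mathbb{R}$ a bounded map, and $\mathcal{U}$ a non-principal ultrafilter on $\mathbb{N}$. Then the Borel probability measure $\eta_{\mathcal{U}}$ on $\beta\mathbb{N}$ is $S$-invariant and, for every $x_0\in X$, writing $$a_m=\frac{\varphi(x_0)+\varphi(T(x_0))+\cdots+\varphi(T^{m-1}(x_0))}{m}\quad(m\in\mathbb{N}),$$ the space mean $$\int_{\beta\mathbb{N}} p\text{-}\lim_m a_m \, d\eta_{\mathcal{U}}(p)$$ is well defined (that is, $p\mapsto p\text{-}\lim_m a_m$ is $\eta_{\mathcal{U}}$-integrable) and is equal to $\int_{\beta\mathbb{N}}\widetilde\psi(p)\,d\eta_{\mathcal{U}}(p)$, where $\widetilde\psi$ is the Birkhoff limit, with respect to $S$ and $\eta_{\mathcal{U}}$, of the observable $\psi(p)=p\text{-}\lim_m a_m$, that is, $$\widetilde\psi(p)=\lim_{n\to\infty}\frac{\left(p\text{-}\lim_m a_m\right)+\left(p\text{-}\lim_m a_{m+1}\right)+\cdots+\left(p\text{-}\lim_m a_{m+n-1}\right)}{n}$$ at $\eta_{\mathcal{U}}$-almost every $p\in\beta\mathbb{N}$.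
   Context: $\beta\mathbb{N}$ is the Stone-Čech compactification of discrete $\mathbb{N}$, identified with the set of all ultrafilters on $\mathbb{N}$ with the topology generated by the sets $\{p : F\in p\}$, $F\subseteq\mathbb{N}$. For $p\in\beta\mathbb{N}$ and a bounded real sequence $(b_n)$, $p\text{-}\lim_n b_n$ is the unique real $\ell$ with $\{n : b_n\in V\}\in p$ for every neighbourhood $V$ of $\ell$. The shift $S:\beta\mathbb{N}\to\beta\mathbb{N}$ is the continuous map $S(p)=\{A\subseteq\mathbb{N} : A-1\in p\}$, where $A-1=\{n\in\mathbb{N} : n+1\in A\}$. The space $C^0(\beta\mathbb{N})$ of continuous real functions on $\beta\mathbb{N}$ is isometrically isomorphic to $\ell_\infty(\mathbb{R})$: a bounded sequence $(b_n)_{n\in\mathbb{N}}$ corresponds to $p\mapsto p\text{-}\lim_n b_n$. Given $\mathcal{U}$, let $\mathcal{L}:C^0(\beta\mathbb{N})\to\mathbb{R}$ be the positive normalized linear functional $$\mathcal{L}(\psi)=\mathcal{U}\text{-}\lim_n\frac{b_1+b_2+\cdots+b_n}{n},$$ where $(b_n)$ is the bounded sequence corresponding to $\psi$. By the Riesz-Markov-Kakutani theorem there is a unique regular Borel probability measure $\eta_{\mathcal{U}}$ on $\beta\mathbb{N}$ with $\mathcal{L}(\psi)=\int_{\beta\mathbb{N}}\psi\,d\eta_{\mathcal{U}}$ for all $\psi\in C^0(\beta\mathbb{N})$; this is the measure in the claim. *)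

theory Defs
  imports "HOL-Probability.Probability"
begin

text \<open>
  The natural numbers of the mathematics start at 1, since the sequences \<open>b\<^sub>1, b\<^sub>2, \<dots>\<close> and the
  averages \<open>a\<^sub>m\<close> (with denominator \<open>m\<close>) are indexed by positive integers. An ultrafilter on
  \<open>{1, 2, \<dots>}\<close> is represented by a filter on \<^typ>\<open>nat\<close> that contains \<open>{1..}\<close>; membership
  \<open>A \<in> p\<close> is \<open>eventually (\<lambda>n. n \<in> A) p\<close>.
\<close>

definition is_ultrafilter :: "nat filter \<Rightarrow> bool" where
  "is_ultrafilter F \<longleftrightarrow> F \<noteq> bot \<and> eventually (\<lambda>n. 1 \<le> n) F \<and>
     (\<forall>A. eventually (\<lambda>n. n \<in> A) F \<or> eventually (\<lambda>n. n \<notin> A) F)"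

lemma is_ultrafilter_principal:
  assumes "1 \<le> n"
  shows "is_ultrafilter (principal {n})"
  using assms by (auto simp: is_ultrafilter_def eventually_principal principal_eq_bot_iff)

typedef betaN = "{F. is_ultrafilter F}" morphisms filter_of Abs_betaN
  using is_ultrafilter_principal[of 1] by auto

instantiation betaN :: topological_space
begin

definition open_betaN :: "betaN set \<Rightarrow> bool" where
  "open_betaN = generate_topology (range (\<lambda>A. {p. eventually (\<lambda>n. n \<in> A) (filter_of p)}))"

instance
  by standard (auto simp: open_betaN_def intro: generate_topology.intros)

end

definition nonprincipal :: "betaN \<Rightarrow> bool" where
  "nonprincipal p \<longleftrightarrow> (\<nexists>n. filter_of p = principal {n})"

text \<open>The limit of a sequence along \<open>p\<close>: \<^const>\<open>Lim\<close> is the definite description of the limit.\<close>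

definition plim :: "betaN \<Rightarrow> (nat \<Rightarrow> real) \<Rightarrow> real" where
  "plim p b = Lim (filter_of p) b"

text \<open>
  \<open>A \<in> betaN_shift p\<close> iff \<open>{n. n + 1 \<in> A} \<in> p\<close>; this is exactly the image filter under \<^const>\<open>Suc\<close>.
\<close>

definition betaN_shift :: "betaN \<Rightarrow> betaN" where
  "betaN_shift p = Abs_betaN (filtermap Suc (filter_of p))"

lemma filter_of_betaN_shift: "filter_of (betaN_shift p) = filtermap Suc (filter_of p)"
proof -
  have u: "is_ultrafilter (filter_of p)"
    using filter_of by simp
  have "is_ultrafilter (filtermap Suc (filter_of p))"
    unfolding is_ultrafilter_def
  proof (intro conjI allI)
    show "filtermap Suc (filter_of p) \<noteq> bot"
      using u by (simp add: is_ultrafilter_def filtermap_bot_iff)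
    show "eventually (\<lambda>n. 1 \<le> n) (filtermap Suc (filter_of p))"
      by (simp add: eventually_filtermap)
    show "eventually (\<lambda>n. n \<in> A) (filtermap Suc (filter_of p)) \<or>
          eventually (\<lambda>n. n \<notin> A) (filtermap Suc (filter_of p))" for A
      using u[unfolded is_ultrafilter_def, THEN conjunct2, THEN conjunct2, rule_format, of "{n. Suc n \<in> A}"]
      by (simp add: eventually_filtermap)
  qed
  then show ?thesis
    unfolding betaN_shift_def by (simp add: Abs_betaN_inverse)
qed

lemma eventually_betaN_shift:
  "eventually (\<lambda>n. n \<in> A) (filter_of (betaN_shift p)) \<longleftrightarrow>
   eventually (\<lambda>n. n \<in> {n. n + 1 \<in> A}) (filter_of p)"
  by (simp add: filter_of_betaN_shift eventually_filtermap)

text \<open>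
  The bounded sequence corresponding to a continuous function on \<^typ>\<open>betaN\<close>. It is unique at the
  indices \<open>n \<ge> 1\<close>; its value at 0 is irrelevant below.
\<close>

definition sequence_of :: "(betaN \<Rightarrow> real) \<Rightarrow> nat \<Rightarrow> real" where
  "sequence_of \<psi> = (SOME b. bounded (range b) \<and> (\<forall>p. \<psi> p = plim p b))"

definition cesaro_functional :: "betaN \<Rightarrow> (betaN \<Rightarrow> real) \<Rightarrow> real" where
  "cesaro_functional U \<psi> = plim U (\<lambda>n. (\<Sum>k = 1..n. sequence_of \<psi> k) / real n)"

definition regular_borel_measure :: "'a::topological_space measure \<Rightarrow> bool" where
  "regular_borel_measure M \<longleftrightarrow> sets M = sets borel \<and>
     (\<forall>A\<in>sets borel.
        emeasure M A = (INF V\<in>{V. open V \<and> A \<subseteq> V}. emeasure M V) \<and>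
        emeasure M A = (SUP K\<in>{K. compact K \<and> closed K \<and> K \<subseteq> A}. emeasure M K))"

definition eta :: "betaN \<Rightarrow> betaN measure" where
  "eta U = (THE M. prob_space M \<and> regular_borel_measure M \<and>
     (\<forall>\<psi>. continuous_on UNIV \<psi> \<longrightarrow> cesaro_functional U \<psi> = (\<integral>p. \<psi> p \<partial>M)))"

definition invariant_measure :: "('a \<Rightarrow> 'a) \<Rightarrow> 'a measure \<Rightarrow> bool" where
  "invariant_measure f M \<longleftrightarrow> f \<in> measurable M M \<and> distr M M f = M"

definition birkhoff_average :: "('a \<Rightarrow> 'a) \<Rightarrow> ('a \<Rightarrow> real) \<Rightarrow> 'a \<Rightarrow> nat \<Rightarrow> real" where
  "birkhoff_average f g x n = (\<Sum>k<n. g ((f ^^ k) x)) / real n"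

definition birkhoff_limit :: "('a \<Rightarrow> 'a) \<Rightarrow> ('a \<Rightarrow> real) \<Rightarrow> 'a \<Rightarrow> real" where
  "birkhoff_limit f g x = lim (birkhoff_average f g x)"

end

(* The functional induced by Cesaro means determines a finitely additive density dens on the clopen
   sets hat A = {p. A in p}, and these form a base of the compact Hausdorff space betaN. Passing to
   suprema over clopen subsets and then to infima over open supersets gives an outer measure for
   which every open set is Caratheodory measurable; its restriction to the Borel sets is eta U.
   (Caratheodory's extension of dens alone would stop at the Baire sets.)

   A regular Borel measure is determined by its values on clopen sets. Hence eta U is unique, and it
   is invariant because the Cesaro density does not change under translation.

   No ergodic theorem is needed: a (m + 1) - a m tends to 0, so p-lim a is invariant under the shift
   at every non-principal p, and the countably many principal p form a null set because U is
   non-principal. The Birkhoff averages are therefore almost everywhere eventually constant. *)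

theory Submission
  imports Defs
begin

section \<open>Ultrafilters and limits along them\<close>

text \<open>Zorn's lemma for the reversed order on the proper filters below \<open>G\<close>: a
  minimal proper filter decides every set. It supplies the point needed for compactness of the
  space.\<close>

lemma ultrafilter_below:
  fixes G :: "'a filter"
  assumes "G \<noteq> bot"
  obtains F where "F \<le> G" "F \<noteq> bot"
    "\<And>A. eventually (\<lambda>n. n \<in> A) F \<or> eventually (\<lambda>n. n \<notin> A) F"
proof -
  define Q where "Q = {F. F \<le> G \<and> F \<noteq> bot}"
  have "\<exists>m\<in>Q. \<forall>a\<in>Q. a \<le> m \<longrightarrow> a = m"
  proof (rule predicate_Zorn[where P = "\<lambda>a b :: 'a filter. b \<le> a"])
    show "partial_order_on Q (relation_of (\<lambda>a b. b \<le> a) Q)"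
      by (rule partial_order_on_relation_ofI) auto
  next
    fix C assume C: "C \<in> Chains (relation_of (\<lambda>a b. b \<le> a) Q)"
    then have CQ: "C \<subseteq> Q" and lin: "\<And>a b. a \<in> C \<Longrightarrow> b \<in> C \<Longrightarrow> a \<le> b \<or> b \<le> a"
      by (auto simp: Chains_def relation_of_def)
    show "\<exists>u\<in>Q. \<forall>a\<in>C. u \<le> a"
    proof (cases "C = {}")
      case True
      then show ?thesis using assms by (auto simp: Q_def)
    next
      case False
      \<comment> \<open>For a nonempty chain, whatever holds eventually in the infimum already holds
        eventually in some member, so properness passes to the infimum.\<close>
      have "eventually P (Inf C) \<longleftrightarrow> (\<exists>b\<in>C. eventually P b)" for P
        by (rule eventually_Inf_base[OF False]) (metis inf.absorb1 inf.absorb2 lin order_refl)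
      then have "Inf C \<noteq> bot"
        using CQ by (auto simp: Q_def trivial_limit_def)
      moreover have "Inf C \<le> G"
        using False CQ by (auto simp: Q_def intro: Inf_lower2)
      ultimately show ?thesis
        by (auto simp: Q_def intro: Inf_lower)
    qed
  qed
  then obtain F where F: "F \<le> G" "F \<noteq> bot"
    and min: "\<And>H. H \<le> G \<Longrightarrow> H \<noteq> bot \<Longrightarrow> H \<le> F \<Longrightarrow> H = F"
    by (auto simp: Q_def)
  \<comment> \<open>Either the trace of \<open>F\<close> on \<open>A\<close> is improper, which puts
    the complement of \<open>A\<close> into \<open>F\<close>, or minimality makes the trace equal to
    \<open>F\<close>, which puts \<open>A\<close> into \<open>F\<close>.\<close>
  have "eventually (\<lambda>n. n \<in> A) F \<or> eventually (\<lambda>n. n \<notin> A) F" for A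
  proof (cases "inf F (principal A) = bot")
    case True
    then show ?thesis
      by (simp add: trivial_limit_def eventually_inf_principal)
  next
    case False
    then have "inf F (principal A) = F"
      using F by (intro min) (auto intro: le_infI1)
    moreover have "eventually (\<lambda>n. n \<in> A) (inf F (principal A))"
      by (simp add: eventually_inf_principal)
    ultimately show ?thesis by simp
  qed
  with F that show ?thesis by blast
qed

lemma ultrafilter_filter_of: "is_ultrafilter (filter_of p)"
  using filter_of by simp

lemma filter_of_not_bot [simp]: "filter_of p \<noteq> bot"
  using ultrafilter_filter_of[of p] by (simp add: is_ultrafilter_def)

lemma filter_of_ge_1: "eventually (\<lambda>n. 1 \<le> n) (filter_of p)"
  using ultrafilter_filter_of[of p] by (simp add: is_ultrafilter_def)

lemma ultra_not_iff:
  "eventually (\<lambda>n. \<not> P n) (filter_of p) \<longleftrightarrow> \<not> eventually P (filter_of p)"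
proof
  assume "eventually (\<lambda>n. \<not> P n) (filter_of p)"
  then show "\<not> eventually P (filter_of p)"
    using eventually_conj[of "\<lambda>n. \<not> P n" "filter_of p" P] by auto
next
  have "eventually (\<lambda>n. n \<in> {n. P n}) (filter_of p) \<or> eventually (\<lambda>n. n \<notin> {n. P n}) (filter_of p)"
    using ultrafilter_filter_of[of p] unfolding is_ultrafilter_def by blast
  then show "\<not> eventually P (filter_of p) \<Longrightarrow> eventually (\<lambda>n. \<not> P n) (filter_of p)"
    by simp
qed

section \<open>Existence and algebra of limits along an ultrafilter\<close>

lemma plim_eqI: "(b \<longlongrightarrow> l) (filter_of p) \<Longrightarrow> plim p b = l"
  unfolding plim_def by (rule tendsto_Lim) auto

text \<open>A compact ball gives a cluster point of the image filter. Along an ultrafilter a cluster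
  point is a limit, since a neighbourhood that is not eventually entered is eventually
  avoided.\<close>

lemma tendsto_plim:
  assumes "bounded (range b)"
  shows "(b \<longlongrightarrow> plim p b) (filter_of p)"
proof -
  obtain C where C: "\<And>n. b n \<in> cball 0 C"
    using assms by (auto simp: bounded_iff)
  have "filtermap b (filter_of p) \<noteq> bot"
    by (simp add: filtermap_bot_iff)
  moreover have "eventually (\<lambda>x. x \<in> cball 0 C) (filtermap b (filter_of p))"
    using C by (simp add: eventually_filtermap)
  ultimately obtain l where l: "inf (nhds l) (filtermap b (filter_of p)) \<noteq> bot"
    using compact_cball[of 0 C] unfolding compact_filter by blast
  have "(b \<longlongrightarrow> l) (filter_of p)"
  proof (rule topological_tendstoI, rule ccontr)
    fix V assume V: "open V" "l \<in> V" "\<not> eventually (\<lambda>n. b n \<in> V) (filter_of p)"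
    then have "eventually (\<lambda>x. x \<notin> V) (filtermap b (filter_of p))"
      by (simp add: ultra_not_iff eventually_filtermap)
    moreover have "eventually (\<lambda>x. x \<in> V) (nhds l)"
      using V by (simp add: eventually_nhds_in_open)
    ultimately have "eventually (\<lambda>x. False) (inf (nhds l) (filtermap b (filter_of p)))"
      unfolding eventually_inf by (metis (mono_tags))
    with l show False by (simp add: trivial_limit_def)
  qed
  then show ?thesis using plim_eqI by metis
qed

lemma plim_add:
  assumes "bounded (range b)" "bounded (range c)"
  shows "plim p (\<lambda>n. b n + c n) = plim p b + plim p c"
  using assms by (intro plim_eqI tendsto_add tendsto_plim)

lemma plim_cmult:
  assumes "bounded (range b)"
  shows "plim p (\<lambda>n. r * b n) = r * plim p b"
  using assms by (intro plim_eqI tendsto_mult_left tendsto_plim)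

lemma plim_le:
  assumes "bounded (range b)" "bounded (range c)" "\<And>n. 1 \<le> n \<Longrightarrow> b n \<le> c n"
  shows "plim p b \<le> plim p c"
  by (rule tendsto_le[OF filter_of_not_bot tendsto_plim[OF assms(2)] tendsto_plim[OF assms(1)]])
    (use filter_of_ge_1[of p] assms(3) in \<open>auto elim: eventually_mono\<close>)

lemma plim_const [simp]: "plim p (\<lambda>n. c) = c"
  by (rule plim_eqI) simp

text \<open>Both sequences have the same limits along \<open>p\<close>, so the definite descriptions
  agree even where no limit exists.\<close>

lemma plim_cong:
  assumes "\<And>n. 1 \<le> n \<Longrightarrow> b n = c n"
  shows "plim p b = plim p c"
proof -
  have "eventually (\<lambda>n. b n = c n) (filter_of p)"
    using filter_of_ge_1[of p] assms by (auto elim: eventually_mono)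
  then have "(b \<longlongrightarrow> l) (filter_of p) \<longleftrightarrow> (c \<longlongrightarrow> l) (filter_of p)" for l
    by (rule tendsto_cong)
  then show ?thesis
    by (simp add: plim_def Topological_Spaces.Lim_def)
qed

lemma plim_diff_le:
  assumes "bounded (range b)" "bounded (range c)" "\<And>n. 1 \<le> n \<Longrightarrow> \<bar>b n - c n\<bar> \<le> e"
  shows "\<bar>plim p b - plim p c\<bar> \<le> e"
proof -
  have "((\<lambda>n. \<bar>b n - c n\<bar>) \<longlongrightarrow> \<bar>plim p b - plim p c\<bar>) (filter_of p)"
    using assms by (intro tendsto_intros tendsto_plim)
  then show ?thesis
    by (rule tendsto_upperbound)
      (use filter_of_ge_1[of p] assms(3) in \<open>auto elim: eventually_mono\<close>)
qed

section \<open>The topology of the space of ultrafilters\<close>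

text \<open>The basic clopen sets. Whether 0 lies in \<open>A\<close> does not affect
  \<open>hat A\<close>, because every ultrafilter here contains \<open>{1..}\<close>; hence the
  recurring side condition \<open>1 \<le> n\<close>.\<close>

definition hat :: "nat set \<Rightarrow> betaN set" where
  "hat A = {p. eventually (\<lambda>n. n \<in> A) (filter_of p)}"

text \<open>The embedding of the positive integers. The value at 0 is some unspecified point,
  because \<open>principal {0}\<close> does not contain \<open>{1..}\<close>.\<close>

definition pt :: "nat \<Rightarrow> betaN" where
  "pt n = Abs_betaN (principal {n})"

lemma filter_of_pt: "1 \<le> n \<Longrightarrow> filter_of (pt n) = principal {n}"
  unfolding pt_def by (simp add: Abs_betaN_inverse is_ultrafilter_principal)

lemma pt_in_hat: "1 \<le> n \<Longrightarrow> pt n \<in> hat A \<longleftrightarrow> n \<in> A"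
  by (simp add: hat_def filter_of_pt eventually_principal)

lemma plim_pt: "1 \<le> n \<Longrightarrow> plim (pt n) b = b n"
  by (rule plim_eqI) (simp add: filter_of_pt tendsto_principal_singleton)

lemma hat_Int: "hat (A \<inter> B) = hat A \<inter> hat B"
  by (auto simp: hat_def eventually_conj_iff)

lemma hat_Compl: "hat (- A) = - hat A"
  by (auto simp: hat_def ultra_not_iff)

lemma hat_Un: "hat (A \<union> B) = hat A \<union> hat B"
  using hat_Int[of "- A" "- B"] hat_Compl by (metis Compl_Int double_complement)

lemma hat_Diff: "hat (A - B) = hat A - hat B"
  by (simp add: Diff_eq hat_Int hat_Compl)

lemma hat_UNIV [simp]: "hat UNIV = UNIV"
  by (simp add: hat_def)

lemma hat_empty [simp]: "hat {} = {}"
  by (simp add: hat_def)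

lemma hat_subset_D: "hat A \<subseteq> hat B \<Longrightarrow> 1 \<le> n \<Longrightarrow> n \<in> A \<Longrightarrow> n \<in> B"
  using pt_in_hat by blast

lemma hat_UN_finite: "finite I \<Longrightarrow> hat (\<Union>i\<in>I. A i) = (\<Union>i\<in>I. hat (A i))"
  by (induction I rule: finite_induct) (auto simp: hat_Un)

text \<open>An ultrafilter containing a singleton is principal, so the principal points are
  isolated.\<close>

lemma hat_singleton:
  assumes "1 \<le> n"
  shows "hat {n} = {pt n}"
proof -
  have "p = pt n" if p: "p \<in> hat {n}" for p
  proof -
    have ev: "eventually (\<lambda>m. m = n) (filter_of p)"
      using p by (simp add: hat_def)
    have "eventually P (filter_of p) \<longleftrightarrow> P n" for P
    proof
      assume "eventually P (filter_of p)"
      with ev have "eventually (\<lambda>m. P n) (filter_of p)"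
        by eventually_elim auto
      then show "P n" by (simp add: eventually_const)
    next
      assume "P n"
      then show "eventually P (filter_of p)"
        using ev by (auto elim: eventually_mono)
    qed
    then have "filter_of p = principal {n}"
      by (auto simp: filter_eq_iff eventually_principal)
    then show ?thesis
      by (metis assms filter_of_inject filter_of_pt)
  qed
  then show ?thesis using assms pt_in_hat by blast
qed

lemma open_hat [simp]: "open (hat A)"
  unfolding open_betaN_def hat_def by (rule generate_topology.Basis) auto

lemma closed_hat [simp]: "closed (hat A)"
  by (simp add: closed_def flip: hat_Compl)

text \<open>The generating sets are closed under finite intersection, so the subbase is already a
  base.\<close>

lemma open_betaN_base:
  assumes "open V" "p \<in> V"
  obtains A where "p \<in> hat A" "hat A \<subseteq> V"
proof -
  have "\<exists>A. p \<in> hat A \<and> hat A \<subseteq> V"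
    using assms unfolding open_betaN_def
  proof (induction rule: generate_topology.induct)
    case UNIV
    then show ?case by (intro exI[of _ UNIV]) auto
  next
    case (Int a b)
    then obtain A B where "p \<in> hat A" "hat A \<subseteq> a" "p \<in> hat B" "hat B \<subseteq> b" by auto
    then show ?case by (intro exI[of _ "A \<inter> B"]) (auto simp: hat_Int)
  next
    case (UN K)
    then show ?case by (metis Union_iff Sup_upper subset_trans)
  next
    case (Basis s)
    then show ?case by (auto simp: hat_def)
  qed
  with that show ?thesis by blast
qed

instance betaN :: t2_space
proof
  fix p q :: betaN
  assume "p \<noteq> q"
  then have "filter_of p \<noteq> filter_of q" by (simp add: filter_of_inject)
  then obtain P where P: "eventually P (filter_of p) \<noteq> eventually P (filter_of q)"
    by (auto simp: filter_eq_iff)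
  define A where "A = (if eventually P (filter_of p) then {n. P n} else {n. \<not> P n})"
  have "p \<in> hat A" "q \<in> hat (- A)"
    using P by (auto simp: A_def hat_def ultra_not_iff)
  moreover have "hat A \<inter> hat (- A) = {}"
    by (simp add: hat_Compl)
  ultimately show "\<exists>U V. open U \<and> open V \<and> p \<in> U \<and> q \<in> V \<and> U \<inter> V = {}"
    using open_hat by blast
qed

text \<open>\<open>D\<close> collects the sets whose clopen set fits into one member of the cover.
  Without a finite subcover their complements have the finite intersection property, and an
  ultrafilter containing all these complements lies in no member of the cover.\<close>

lemma compact_betaN: "compact (UNIV :: betaN set)"
  unfolding compact_eq_Heine_Borel
proof (intro allI impI, rule ccontr)
  fix C :: "betaN set set"
  assume "(\<forall>c\<in>C. open c) \<and> UNIV \<subseteq> \<Union>C"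
  then have C: "\<forall>t\<in>C. open t" "UNIV \<subseteq> \<Union>C" by auto
  assume no: "\<not> (\<exists>C'\<subseteq>C. finite C' \<and> UNIV \<subseteq> \<Union>C')"
  define D where "D = {A. \<exists>c\<in>C. hat A \<subseteq> c}"
  define G where "G = (\<Sqinter>A\<in>D. principal (- A \<inter> {1..}))"
  have "G \<noteq> bot"
    unfolding G_def
  proof (rule INF_filter_not_bot)
    fix X assume X: "X \<subseteq> D" "finite X"
    then have "\<forall>A\<in>X. \<exists>c. c \<in> C \<and> hat A \<subseteq> c"
      by (auto simp: D_def)
    then obtain f where f: "\<forall>A\<in>X. f A \<in> C \<and> hat A \<subseteq> f A"
      using bchoice by metis
    then have "f ` X \<subseteq> C" by auto
    then have "\<not> UNIV \<subseteq> \<Union>(f ` X)"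
      using no X by blast
    \<comment> \<open>A point missed by the finite subfamily contains the complement of
      \<open>\<Union>X\<close>; as a proper filter containing \<open>{1..}\<close> it yields a
      positive integer in that complement.\<close>
    then obtain p where "p \<notin> \<Union>(f ` X)" by blast
    then have "p \<notin> hat (\<Union>A\<in>X. A)"
      using f X by (subst hat_UN_finite) auto
    then have "eventually (\<lambda>n. n \<notin> \<Union>X) (filter_of p)"
      using ultra_not_iff[of "\<lambda>n. n \<in> \<Union>X" p] by (simp add: hat_def)
    with filter_of_ge_1[of p] have "eventually (\<lambda>n. 1 \<le> n \<and> n \<notin> \<Union>X) (filter_of p)"
      by (simp add: eventually_conj_iff)
    then obtain n where "1 \<le> n" "n \<notin> \<Union>X"
      using eventually_happens' filter_of_not_bot by blast
    then have "n \<in> (\<Inter>A\<in>X. - A \<inter> {1..})" by auto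
    moreover have "(\<Sqinter>A\<in>X. principal (- A \<inter> {1..})) = principal (\<Inter>A\<in>X. - A \<inter> {1..})"
      by (rule INF_principal_finite[OF X(2)])
    ultimately show "(\<Sqinter>A\<in>X. principal (- A \<inter> {1..})) \<noteq> bot"
      by (metis empty_iff principal_eq_bot_iff)
  qed
  \<comment> \<open>For empty \<open>D\<close> the filter \<open>G\<close> is the top filter, and
    \<open>{1..}\<close> has to be added to obtain an ultrafilter on the positive integers.\<close>
  have "inf G (principal {1..}) \<noteq> bot"
  proof (cases "D = {}")
    case False
    then obtain A where "A \<in> D" by auto
    then have "G \<le> principal (- A \<inter> {1..})"
      unfolding G_def by (rule INF_lower)
    also have "\<dots> \<le> principal {1..}" by simp
    finally have "inf G (principal {1..}) = G" by (simp add: inf.absorb1)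
    then show ?thesis
      using \<open>G \<noteq> bot\<close> by simp
  qed (auto simp: G_def principal_eq_bot_iff)
  then obtain F where F: "F \<le> inf G (principal {1..})" "F \<noteq> bot"
    and u: "\<And>A. eventually (\<lambda>n. n \<in> A) F \<or> eventually (\<lambda>n. n \<notin> A) F"
    by (rule ultrafilter_below) blast
  have "eventually (\<lambda>n. n \<in> {1..}) F"
    using F(1) by (metis le_inf_iff le_principal)
  with F u have "is_ultrafilter F" by (simp add: is_ultrafilter_def)
  then have p: "filter_of (Abs_betaN F) = F" by (simp add: Abs_betaN_inverse)
  obtain c where c: "c \<in> C" "Abs_betaN F \<in> c" using C by blast
  then obtain A where A: "Abs_betaN F \<in> hat A" "hat A \<subseteq> c"
    using C by (metis open_betaN_base)
  then have "A \<in> D" using c by (auto simp: D_def)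
  then have "F \<le> principal (- A \<inter> {1..})"
    using F(1) unfolding G_def by (meson INF_lower le_inf_iff order_trans)
  then have "eventually (\<lambda>n. n \<notin> A) F"
    by (simp add: le_principal eventually_conj_iff)
  moreover have "eventually (\<lambda>n. n \<in> A) F"
    using A p by (simp add: hat_def)
  ultimately show False
    using F(2) eventually_conj[of "\<lambda>n. n \<notin> A" F "\<lambda>n. n \<in> A"] by (simp add: trivial_limit_def)
qed

lemma closed_imp_compact_betaN: "closed (K :: betaN set) \<Longrightarrow> compact K"
  using compact_Int_closed[OF compact_betaN] by fastforce

lemma compact_hat_cover:
  assumes "compact K" "K \<subseteq> \<Union>\<V>" "\<And>V. V \<in> \<V> \<Longrightarrow> open V"
  obtains \<A> where "finite \<A>" "K \<subseteq> (\<Union>A\<in>\<A>. hat A)" "\<And>A. A \<in> \<A> \<Longrightarrow> \<exists>V\<in>\<V>. hat A \<subseteq> V"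
proof -
  let ?B = "{A. \<exists>V\<in>\<V>. hat A \<subseteq> V}"
  have "K \<subseteq> (\<Union>A\<in>?B. hat A)"
  proof
    fix p assume "p \<in> K"
    then obtain V where "V \<in> \<V>" "p \<in> V" using assms by blast
    moreover then obtain A where "p \<in> hat A" "hat A \<subseteq> V"
      using assms(3) by (metis open_betaN_base)
    ultimately show "p \<in> (\<Union>A\<in>?B. hat A)" by blast
  qed
  then obtain \<A> where "\<A> \<subseteq> ?B" "finite \<A>" "K \<subseteq> (\<Union>A\<in>\<A>. hat A)"
    using compactE_image[OF assms(1), of ?B hat] by auto
  then show ?thesis using that by blast
qed

text \<open>Zero-dimensional substitute for Urysohn's lemma: finitely many basic clopen sets cover
  \<open>K\<close> inside \<open>V\<close>, and their union is again of the form
  \<open>hat A\<close>. Both subadditivity of the content and uniqueness of regular measures rest on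
  it.\<close>

lemma compact_open_separation:
  assumes "compact K" "open V" "K \<subseteq> V"
  obtains A where "K \<subseteq> hat A" "hat A \<subseteq> V"
proof -
  obtain \<A> where A: "finite \<A>" "K \<subseteq> (\<Union>A\<in>\<A>. hat A)" "\<And>A. A \<in> \<A> \<Longrightarrow> \<exists>W\<in>{V}. hat A \<subseteq> W"
    using compact_hat_cover[of K "{V}"] assms by auto
  have "hat (\<Union>A\<in>\<A>. A) = (\<Union>A\<in>\<A>. hat A)"
    using hat_UN_finite[OF A(1), of "\<lambda>A. A"] by simp
  then show ?thesis using A that[of "\<Union>A\<in>\<A>. A"] by auto
qed

section \<open>Continuous functions as bounded sequences\<close>

lemma continuous_plim:
  assumes "bounded (range b)"
  shows "continuous_on UNIV (\<lambda>p. plim p b)"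
proof -
  have "((\<lambda>p. plim p b) \<longlongrightarrow> plim p b) (nhds p)" for p
  proof (rule tendstoI)
    fix e :: real assume e: "e > 0"
    \<comment> \<open>The radius is halved because a strict bound on \<open>A\<close> becomes only a
      weak bound for the limit along any \<open>q\<close> in \<open>hat A\<close>.\<close>
    define A where "A = {n. dist (b n) (plim p b) < e / 2}"
    have "p \<in> hat A"
      using tendstoD[OF tendsto_plim[OF assms], of "e / 2" p] e by (simp add: hat_def A_def)
    moreover have "dist (plim q b) (plim p b) < e" if "q \<in> hat A" for q
    proof -
      have "((\<lambda>n. dist (b n) (plim p b)) \<longlongrightarrow> dist (plim q b) (plim p b)) (filter_of q)"
        by (intro tendsto_intros tendsto_plim assms)
      then have "dist (plim q b) (plim p b) \<le> e / 2"
        using that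
        by (rule_tac tendsto_upperbound) (auto simp: hat_def A_def elim: eventually_mono)
      with e show ?thesis by simp
    qed
    ultimately show "eventually (\<lambda>q. dist (plim q b) (plim p b) < e) (nhds p)"
      unfolding eventually_nhds using open_hat by blast
  qed
  then show ?thesis
    by (auto simp: continuous_on_def intro: tendsto_mono[OF at_within_le_nhds])
qed

text \<open>The points \<open>pt n\<close> converge to \<open>p\<close> along \<open>p\<close>
  itself, so a continuous function is recovered from its values at the principal points.\<close>

lemma continuous_eq_plim:
  fixes \<psi> :: "betaN \<Rightarrow> real"
  assumes "continuous_on UNIV \<psi>"
  shows "bounded (range (\<lambda>n. \<psi> (pt n)))" and "\<psi> p = plim p (\<lambda>n. \<psi> (pt n))"
proof -
  show "bounded (range (\<lambda>n. \<psi> (pt n)))"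
    using compact_imp_bounded[OF compact_continuous_image[OF assms compact_betaN]]
    by (rule bounded_subset) auto
  have "((\<lambda>n. \<psi> (pt n)) \<longlongrightarrow> \<psi> p) (filter_of p)"
  proof (rule topological_tendstoI)
    fix V assume V: "open V" "\<psi> p \<in> V"
    have "open (\<psi> -` V)"
      using assms V by (simp add: continuous_on_open_vimage)
    then obtain A where "p \<in> hat A" "hat A \<subseteq> \<psi> -` V"
      using V by (metis open_betaN_base vimageI2)
    then have A: "eventually (\<lambda>n. n \<in> A) (filter_of p)" and AV: "\<And>n. 1 \<le> n \<Longrightarrow> n \<in> A \<Longrightarrow> \<psi> (pt n) \<in> V"
      using pt_in_hat by (auto simp: hat_def)
    from A filter_of_ge_1[of p] show "eventually (\<lambda>n. \<psi> (pt n) \<in> V) (filter_of p)"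
      by eventually_elim (rule AV)
  qed
  then show "\<psi> p = plim p (\<lambda>n. \<psi> (pt n))"
    by (simp add: plim_eqI)
qed

text \<open>Evaluating at principal ultrafilters pins down the chosen sequence at every positive
  index.\<close>

lemma sequence_of_eq:
  assumes "continuous_on UNIV \<psi>" "1 \<le> n"
  shows "sequence_of \<psi> n = \<psi> (pt n)"
proof -
  have "bounded (range (sequence_of \<psi>)) \<and> (\<forall>p. \<psi> p = plim p (sequence_of \<psi>))"
    unfolding sequence_of_def
    by (rule someI[of _ "\<lambda>n. \<psi> (pt n)"]) (intro conjI allI continuous_eq_plim assms(1))
  then show ?thesis using plim_pt[OF assms(2)] by simp
qed

lemma continuous_betaN_shift: "continuous_on UNIV betaN_shift"
  unfolding continuous_on_open_vimage[OF open_UNIV]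
proof (intro allI impI)
  fix V :: "betaN set" assume V: "open V"
  have "betaN_shift -` V = (\<Union>A\<in>{A. hat A \<subseteq> V}. hat (Suc -` A))"
  proof (intro set_eqI iffI)
    fix p assume "p \<in> betaN_shift -` V"
    then obtain A where "betaN_shift p \<in> hat A" "hat A \<subseteq> V"
      using V by (metis open_betaN_base vimageE)
    then show "p \<in> (\<Union>A\<in>{A. hat A \<subseteq> V}. hat (Suc -` A))"
      using eventually_betaN_shift by (auto simp: hat_def)
  next
    fix p assume "p \<in> (\<Union>A\<in>{A. hat A \<subseteq> V}. hat (Suc -` A))"
    then obtain A where "hat A \<subseteq> V" "betaN_shift p \<in> hat A"
      using eventually_betaN_shift by (auto simp: hat_def)
    then show "p \<in> betaN_shift -` V" by blast
  qed
  then show "open (betaN_shift -` V \<inter> UNIV)" by auto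
qed

lemma vimage_betaN_shift_hat: "betaN_shift -` hat A = hat (Suc -` A)"
  using eventually_betaN_shift by (auto simp: hat_def)

section \<open>Density along an ultrafilter\<close>

text \<open>The Cesaro functional read directly on sequences, which avoids the choice hidden in
  \<open>sequence_of\<close>.\<close>

definition mean :: "betaN \<Rightarrow> (nat \<Rightarrow> real) \<Rightarrow> real" where
  "mean U b = plim U (\<lambda>n. (\<Sum>k = 1..n. b k) / real n)"

definition dens :: "betaN \<Rightarrow> nat set \<Rightarrow> real" where
  "dens U A = mean U (indicator A)"

lemma average_bound:
  fixes b :: "nat \<Rightarrow> real"
  assumes "\<And>n. \<bar>b n\<bar> \<le> C"
  shows "\<bar>(\<Sum>k = 1..n. b k) / real n\<bar> \<le> C"
proof (cases "n = 0")
  case True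
  \<comment> \<open>Division by zero gives 0 here, and \<open>C\<close> is nonnegative because it
    bounds an absolute value.\<close>
  then show ?thesis using assms[of 0] by simp
next
  case False
  have "\<bar>\<Sum>k = 1..n. b k\<bar> \<le> (\<Sum>k = 1..n. \<bar>b k\<bar>)"
    by (rule sum_abs)
  also have "\<dots> \<le> (\<Sum>k = 1..n. C)"
    by (intro sum_mono assms)
  finally show ?thesis
    using False by (simp add: field_simps)
qed

lemma bounded_average:
  fixes b :: "nat \<Rightarrow> real"
  assumes "bounded (range b)"
  shows "bounded (range (\<lambda>n. (\<Sum>k = 1..n. b k) / real n))"
proof -
  obtain C where "\<And>n. \<bar>b n\<bar> \<le> C"
    using assms by (auto simp: bounded_iff)
  then have "\<And>n. \<bar>(\<Sum>k = 1..n. b k) / real n\<bar> \<le> C"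
    by (rule average_bound)
  then show ?thesis
    by (auto simp: bounded_iff)
qed

lemma bounded_indicator: "bounded (range (indicator A :: nat \<Rightarrow> real))"
  by (rule boundedI[of _ 1]) (auto simp: indicator_def)

lemma bounded_range_cmult:
  fixes b :: "nat \<Rightarrow> real"
  assumes "bounded (range b)"
  shows "bounded (range (\<lambda>n. r * b n))"
  using bounded_scaling[OF assms, of r] by (simp add: image_image)

lemma mean_add:
  assumes "bounded (range b)" "bounded (range c)"
  shows "mean U (\<lambda>n. b n + c n) = mean U b + mean U c"
  unfolding mean_def using plim_add[OF bounded_average bounded_average, OF assms]
  by (simp add: sum.distrib add_divide_distrib)

lemma mean_cmult:
  assumes "bounded (range b)"
  shows "mean U (\<lambda>n. r * b n) = r * mean U b"
  unfolding mean_def using plim_cmult[OF bounded_average, OF assms, of U r]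
  by (simp flip: sum_distrib_left)

lemma mean_diff_le:
  assumes "bounded (range b)" "bounded (range c)" "\<And>n. \<bar>b n - c n\<bar> \<le> e"
  shows "\<bar>mean U b - mean U c\<bar> \<le> e"
  unfolding mean_def
proof (rule plim_diff_le[OF bounded_average bounded_average, OF assms(1,2)])
  fix n
  show "\<bar>(\<Sum>k = 1..n. b k) / real n - (\<Sum>k = 1..n. c k) / real n\<bar> \<le> e"
    using average_bound[of "\<lambda>k. b k - c k" e n, OF assms(3)]
    by (simp add: sum_subtractf diff_divide_distrib)
qed

lemma mean_cong:
  assumes "\<And>n. 1 \<le> n \<Longrightarrow> b n = c n"
  shows "mean U b = mean U c"
proof -
  have "(\<lambda>n. (\<Sum>k = 1..n. b k) / real n) = (\<lambda>n. (\<Sum>k = 1..n. c k) / real n)"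
    using assms by (intro ext arg_cong2[where f = "(/)"] sum.cong) auto
  then show ?thesis by (simp add: mean_def)
qed

text \<open>Disjointness is asked only at positive indices: the averages start at 1, and disjoint
  clopen sets give no more than that.\<close>

lemma dens_Un:
  assumes "\<And>n. 1 \<le> n \<Longrightarrow> n \<in> A \<Longrightarrow> n \<in> B \<Longrightarrow> False"
  shows "dens U (A \<union> B) = dens U A + dens U B"
proof -
  have "dens U (A \<union> B) = mean U (\<lambda>n. indicator A n + indicator B n)"
    unfolding dens_def using assms by (intro mean_cong) (auto simp: indicator_def)
  then show ?thesis
    by (simp add: mean_add bounded_indicator dens_def)
qed

lemma dens_nonneg: "0 \<le> dens U A"
proof -
  have "plim U (\<lambda>n. 0) \<le> dens U A"
    unfolding dens_def mean_def
    by (intro plim_le bounded_average bounded_indicator) (auto intro!: divide_nonneg_nonneg sum_nonneg)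
  then show ?thesis by simp
qed

lemma dens_mono: "A \<subseteq> B \<Longrightarrow> dens U A \<le> dens U B"
  using dens_Un[of A "B - A" U] dens_nonneg[of U "B - A"] by (auto simp: Un_absorb1)

lemma dens_UNIV: "dens U UNIV = 1"
proof -
  have "dens U UNIV = plim U (\<lambda>n. 1)"
    unfolding dens_def mean_def by (rule plim_cong) simp
  then show ?thesis by simp
qed

text \<open>Such an \<open>A\<close> is disjoint from itself at positive indices, so additivity
  gives \<open>dens U A = dens U A + dens U A\<close>.\<close>

lemma dens_eq_0: "(\<And>n. 1 \<le> n \<Longrightarrow> n \<notin> A) \<Longrightarrow> dens U A = 0"
  using dens_Un[of A A U] by simp

section \<open>Construction of the measure\<close>

definition inner_content :: "betaN \<Rightarrow> betaN set \<Rightarrow> ennreal" where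
  "inner_content U V = (SUP A\<in>{A. hat A \<subseteq> V}. ennreal (dens U A))"

definition outer_content :: "betaN \<Rightarrow> betaN set \<Rightarrow> ennreal" where
  "outer_content U E = (INF V\<in>{V. open V \<and> E \<subseteq> V}. inner_content U V)"

lemma dens_le_inner_content: "hat A \<subseteq> V \<Longrightarrow> ennreal (dens U A) \<le> inner_content U V"
  unfolding inner_content_def by (rule SUP_upper) simp

lemma inner_content_least:
  "(\<And>A. hat A \<subseteq> V \<Longrightarrow> ennreal (dens U A) \<le> c) \<Longrightarrow> inner_content U V \<le> c"
  unfolding inner_content_def by (rule SUP_least) simp

lemma inner_content_mono: "V \<subseteq> W \<Longrightarrow> inner_content U V \<le> inner_content U W"
  by (rule inner_content_least) (auto intro: dens_le_inner_content)

lemma inner_content_hat: "inner_content U (hat A) = ennreal (dens U A)"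
proof (rule antisym[OF inner_content_least dens_le_inner_content[OF order_refl]])
  fix B assume B: "hat B \<subseteq> hat A"
  \<comment> \<open>Inclusion of clopen sets is inclusion of index sets up to 0, which carries no
    density.\<close>
  have "B - A \<subseteq> {0}"
    using hat_subset_D[OF B] by (metis DiffE One_nat_def Suc_leI gr0I singleton_iff subsetI)
  then have "dens U (B - A) = 0"
    by (intro dens_eq_0) auto
  moreover have "dens U B = dens U (B \<inter> A) + dens U (B - A)"
    by (subst dens_Un[symmetric]) (auto simp: Int_Diff_Un)
  ultimately show "ennreal (dens U B) \<le> ennreal (dens U A)"
    using dens_mono[of "B \<inter> A" A U] by (simp add: ennreal_leI)
qed

lemma inner_content_empty: "inner_content U {} = 0"
  using inner_content_hat[of U "{}"] dens_eq_0[of "{}" U] by simp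

text \<open>A clopen set inside \<open>V \<union> W\<close> splits into clopen pieces: the compact
  remainder outside \<open>W\<close> is enclosed in some \<open>hat B\<close> inside
  \<open>V\<close>, and what lies outside \<open>hat B\<close> is inside \<open>W\<close>.\<close>

lemma inner_content_Un:
  assumes V: "open V" and W: "open W"
  shows "inner_content U (V \<union> W) \<le> inner_content U V + inner_content U W"
proof (rule inner_content_least)
  fix A assume A: "hat A \<subseteq> V \<union> W"
  have "compact (hat A - W)"
    using W by (intro closed_imp_compact_betaN closed_Diff) auto
  then obtain B where B: "hat A - W \<subseteq> hat B" "hat B \<subseteq> V"
    using compact_open_separation[of "hat A - W" V] V A by auto
  have "dens U A = dens U (A \<inter> B) + dens U (A - B)"
    by (subst dens_Un[symmetric]) (auto simp: Int_Diff_Un)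
  then have "ennreal (dens U A) = ennreal (dens U (A \<inter> B)) + ennreal (dens U (A - B))"
    by (simp add: dens_nonneg)
  also have "\<dots> \<le> inner_content U V + inner_content U W"
    using A B by (intro add_mono dens_le_inner_content) (auto simp: hat_Int hat_Diff)
  finally show "ennreal (dens U A) \<le> inner_content U V + inner_content U W" .
qed

lemma inner_content_UN_finite:
  assumes "finite I" "\<And>i. i \<in> I \<Longrightarrow> open (V i)"
  shows "inner_content U (\<Union>i\<in>I. V i) \<le> (\<Sum>i\<in>I. inner_content U (V i))"
  using assms
proof (induction I rule: finite_induct)
  case empty
  then show ?case by (simp add: inner_content_empty)
next
  case (insert i I)
  have "inner_content U (V i \<union> (\<Union>j\<in>I. V j)) \<le> inner_content U (V i) + inner_content U (\<Union>j\<in>I. V j)"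
    using insert by (intro inner_content_Un) auto
  also have "\<dots> \<le> inner_content U (V i) + (\<Sum>i\<in>I. inner_content U (V i))"
    using insert by (intro add_left_mono) auto
  finally show ?case using insert by simp
qed

text \<open>Clopen sets are compact, so countable subadditivity reduces to the finite case.\<close>

lemma inner_content_UN:
  fixes V :: "nat \<Rightarrow> betaN set"
  assumes V: "\<And>i. open (V i)"
  shows "inner_content U (\<Union>i. V i) \<le> (\<Sum>i. inner_content U (V i))"
proof (rule inner_content_least)
  fix A assume "hat A \<subseteq> (\<Union>i. V i)"
  moreover have "compact (hat A)"
    by (intro closed_imp_compact_betaN) auto
  ultimately obtain I where I: "finite I" "hat A \<subseteq> (\<Union>i\<in>I. V i)"
    using compactE_image[of "hat A" UNIV V] V by auto
  have "ennreal (dens U A) \<le> inner_content U (\<Union>i\<in>I. V i)"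
    by (rule dens_le_inner_content) fact
  also have "\<dots> \<le> (\<Sum>i\<in>I. inner_content U (V i))"
    using I V by (intro inner_content_UN_finite) auto
  also have "\<dots> \<le> (\<Sum>i. inner_content U (V i))"
    using I by (intro sum_le_suminf) auto
  finally show "ennreal (dens U A) \<le> (\<Sum>i. inner_content U (V i))" .
qed

section \<open>The outer measure and Caratheodory measurability of open sets\<close>

lemma outer_content_le: "open V \<Longrightarrow> E \<subseteq> V \<Longrightarrow> outer_content U E \<le> inner_content U V"
  unfolding outer_content_def by (rule INF_lower) simp

lemma outer_content_open: "open V \<Longrightarrow> outer_content U V = inner_content U V"
  by (rule antisym[OF outer_content_le])
    (auto simp: outer_content_def intro!: INF_greatest inner_content_mono)

lemma outer_content_approx:
  assumes "e > (0::real)" "outer_content U E < top"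
  obtains V where "open V" "E \<subseteq> V" "inner_content U V \<le> outer_content U E + ennreal e"
proof -
  have "outer_content U E < outer_content U E + ennreal e"
    using assms by (cases "outer_content U E" rule: ennreal_cases) auto
  then show ?thesis
    using that unfolding outer_content_def INF_less_iff by (auto intro: less_imp_le)
qed

lemma outer_content_space: "outer_content U UNIV = 1"
  using inner_content_hat[of U UNIV] by (simp add: outer_content_open dens_UNIV)

lemma outer_content_mono: "E \<subseteq> F \<Longrightarrow> outer_content U E \<le> outer_content U F"
  unfolding outer_content_def by (rule INF_superset_mono) auto

lemma outer_content_finite: "outer_content U E < top"
  using outer_content_mono[of E UNIV U] by (simp add: outer_content_space order_le_less_trans)

lemma outer_measure_space_outer_content: "outer_measure_space UNIV (outer_content U)"
  unfolding outer_measure_space_def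
proof (intro conjI)
  show "positive UNIV (outer_content U)"
    by (simp add: positive_def outer_content_open inner_content_empty)
  show "increasing UNIV (outer_content U)"
    by (simp add: increasing_def outer_content_mono)
  show "countably_subadditive UNIV (outer_content U)"
    unfolding countably_subadditive_def
  proof (intro allI impI)
    fix E :: "nat \<Rightarrow> betaN set"
    show "outer_content U (\<Union>i. E i) \<le> (\<Sum>i. outer_content U (E i))"
    proof (rule ennreal_le_epsilon)
      fix e :: real assume e: "0 < e"
      \<comment> \<open>The tolerances \<open>e / 2 ^ (i + 1)\<close> add up to
        \<open>e\<close>.\<close>
      have "\<exists>V. open V \<and> E i \<subseteq> V \<and> inner_content U V \<le> outer_content U (E i) + ennreal (e * (1/2) ^ Suc i)" for i
        using outer_content_approx[OF _ outer_content_finite, of "e * (1/2) ^ Suc i"] e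
        by (metis half_gt_zero_iff mult_pos_pos zero_less_one zero_less_power)
      then obtain V where V: "\<And>i. open (V i)" "\<And>i. E i \<subseteq> V i"
        "\<And>i. inner_content U (V i) \<le> outer_content U (E i) + ennreal (e * (1/2) ^ Suc i)"
        by metis
      have "outer_content U (\<Union>i. E i) \<le> inner_content U (\<Union>i. V i)"
        using V by (intro outer_content_le) auto
      also have "\<dots> \<le> (\<Sum>i. inner_content U (V i))"
        by (rule inner_content_UN) fact
      also have "\<dots> \<le> (\<Sum>i. outer_content U (E i) + ennreal (e * (1/2) ^ Suc i))"
        by (intro suminf_le V) auto
      also have "\<dots> = (\<Sum>i. outer_content U (E i)) + (\<Sum>i. ennreal (e * (1/2) ^ Suc i))"
        by (intro suminf_add[symmetric]) auto
      also have "(\<Sum>i. ennreal (e * (1/2) ^ Suc i)) = ennreal e"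
      proof (rule suminf_ennreal_eq)
        show "(\<lambda>i. e * (1/2) ^ Suc i) sums e"
          using sums_mult[OF power_half_series, of e] by simp
      qed (use e in auto)
      finally show "outer_content U (\<Union>i. E i) \<le> (\<Sum>i. outer_content U (E i)) + ennreal e" .
    qed
  qed
qed

text \<open>The nontrivial half of Caratheodory's condition. Inside an open \<open>G\<close>
  containing \<open>E\<close>, a clopen \<open>hat A\<close> exhausts \<open>G \<inter> V\<close>
  and a clopen \<open>hat B\<close> exhausts \<open>G - hat A\<close>; these are disjoint, so their
  densities add up to at most the content of \<open>G\<close>.\<close>

lemma outer_content_split:
  assumes V: "open V"
  shows "outer_content U (E \<inter> V) + outer_content U (E - V) \<le> outer_content U E"
  unfolding outer_content_def[of U E]
proof (rule INF_greatest)
  fix G assume "G \<in> {G. open G \<and> E \<subseteq> G}"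
  then have G: "open G" "E \<subseteq> G" by auto
  have "outer_content U (E \<inter> V) + outer_content U (E - V) \<le> inner_content U (G \<inter> V) + outer_content U (G - V)"
    using V G by (intro add_mono outer_content_le outer_content_mono) auto
  \<comment> \<open>Addition commutes with this supremum because its index set is nonempty: it
    contains the empty set.\<close>
  also have "\<dots> = (SUP A\<in>{A. hat A \<subseteq> G \<inter> V}. ennreal (dens U A) + outer_content U (G - V))"
    unfolding inner_content_def by (rule ennreal_SUP_add_left[symmetric]) (auto intro!: exI[of _ "{}"])
  also have "\<dots> \<le> inner_content U G"
  proof (rule SUP_least)
    fix A assume "A \<in> {A. hat A \<subseteq> G \<inter> V}"
    then have A: "hat A \<subseteq> G" "hat A \<subseteq> V" by auto
    \<comment> \<open>\<open>G - V\<close> need not be open, but the larger set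
      \<open>G - hat A\<close> is, because \<open>hat A\<close> is closed.\<close>
    have "outer_content U (G - V) \<le> inner_content U (G - hat A)"
      using A G by (intro outer_content_le open_Diff) auto
    then have "ennreal (dens U A) + outer_content U (G - V) \<le> ennreal (dens U A) + inner_content U (G - hat A)"
      by (rule add_left_mono)
    also have "\<dots> = (SUP B\<in>{B. hat B \<subseteq> G - hat A}. ennreal (dens U A) + ennreal (dens U B))"
      unfolding inner_content_def by (rule ennreal_SUP_add_right) (auto intro!: exI[of _ "{}"])
    also have "\<dots> \<le> inner_content U G"
    proof (rule SUP_least)
      fix B assume "B \<in> {B. hat B \<subseteq> G - hat A}"
      then have B: "hat B \<subseteq> G - hat A" by auto
      then have "dens U (A \<union> B) = dens U A + dens U B"
        using pt_in_hat by (intro dens_Un) blast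
      then have "ennreal (dens U A) + ennreal (dens U B) = ennreal (dens U (A \<union> B))"
        by (simp add: dens_nonneg)
      also have "\<dots> \<le> inner_content U G"
        using A B by (intro dens_le_inner_content) (auto simp: hat_Un)
      finally show "ennreal (dens U A) + ennreal (dens U B) \<le> inner_content U G" .
    qed
    finally show "ennreal (dens U A) + outer_content U (G - V) \<le> inner_content U G" .
  qed
  finally show "outer_content U (E \<inter> V) + outer_content U (E - V) \<le> inner_content U G" .
qed

text \<open>Caratheodory's lemma is applied on the full power set. The resulting system is a
  sigma-algebra containing the open sets, hence all Borel sets.\<close>

lemma measure_space_outer_content: "measure_space UNIV (sets borel) (outer_content U)"
proof -
  interpret P: sigma_algebra UNIV "UNIV :: betaN set set"
    using sigma_algebra_Pow[of "UNIV :: betaN set"] by simp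
  let ?L = "lambda_system UNIV UNIV (outer_content U)"
  have L: "measure_space UNIV ?L (outer_content U)"
    by (rule P.caratheodory_lemma[OF outer_measure_space_outer_content])
  have "V \<in> ?L" if "open V" for V
  proof -
    have "outer_content U (E \<inter> V) + outer_content U (E - V) = outer_content U E" for E
    proof (rule antisym[OF outer_content_split[OF that]])
      have "subadditive UNIV (outer_content U)"
        using outer_measure_space_outer_content[of U] unfolding outer_measure_space_def
        by (intro P.countably_subadditive_subadditive) auto
      then have "outer_content U ((E \<inter> V) \<union> (E - V)) \<le> outer_content U (E \<inter> V) + outer_content U (E - V)"
        by (rule subadditiveD) auto
      then show "outer_content U E \<le> outer_content U (E \<inter> V) + outer_content U (E - V)"
        by (simp add: Int_Diff_Un)
    qed
    then show ?thesis by (simp add: P.lambda_system_eq)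
  qed
  then have "{V. open V} \<subseteq> ?L" by auto
  moreover have "sigma_algebra UNIV ?L"
    using L by (simp add: measure_space_def)
  ultimately have "sigma_sets UNIV {V. open V} \<subseteq> ?L"
    by (rule sigma_algebra.sigma_sets_subset[rotated])
  then show ?thesis
    using L by (intro measure_down[OF L]) (auto simp: sets_borel sigma_algebra_sigma_sets)
qed

definition content_measure :: "betaN \<Rightarrow> betaN measure" where
  "content_measure U = measure_of UNIV (sets borel) (outer_content U)"

lemma sets_content_measure [simp]: "sets (content_measure U) = sets borel"
  unfolding content_measure_def
  using sets.sigma_sets_eq[of "borel :: betaN measure"] by (simp add: sets_measure_of)

lemma emeasure_content_measure:
  "E \<in> sets borel \<Longrightarrow> emeasure (content_measure U) E = outer_content U E"
  unfolding content_measure_def using measure_space_outer_content[of U]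
  by (intro emeasure_measure_of_sigma) (auto simp: measure_space_def)

lemma borel_hat [simp]: "hat A \<in> sets borel"
  by (rule borel_open) simp

lemma emeasure_content_measure_hat: "emeasure (content_measure U) (hat A) = ennreal (dens U A)"
  by (simp add: emeasure_content_measure outer_content_open inner_content_hat)

lemma space_eq_UNIV: "sets M = sets borel \<Longrightarrow> space M = UNIV"
  by (metis sets_eq_imp_space_eq space_borel)

lemma prob_space_content_measure: "prob_space (content_measure U)"
  by (rule prob_spaceI) (simp add: space_eq_UNIV emeasure_content_measure outer_content_space)

section \<open>Regular measures\<close>

lemma
  assumes "regular_borel_measure M"
  shows regular_sets: "sets M = sets borel"
    and regular_outer: "A \<in> sets borel \<Longrightarrow> emeasure M A = (INF V\<in>{V. open V \<and> A \<subseteq> V}. emeasure M V)"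
    and regular_inner: "A \<in> sets borel \<Longrightarrow>
      emeasure M A = (SUP K\<in>{K. compact K \<and> closed K \<and> K \<subseteq> A}. emeasure M K)"
  using assms unfolding regular_borel_measure_def by blast+

text \<open>Inner approximation by closed sets suffices: closed sets are compact here, and for a
  finite measure complements turn inner approximation into outer approximation.\<close>

lemma regular_borel_measureI:
  fixes M :: "betaN measure"
  assumes "finite_measure M" and M: "sets M = sets borel"
    and inner: "\<And>A e. A \<in> sets borel \<Longrightarrow> e > 0 \<Longrightarrow> \<exists>K. closed K \<and> K \<subseteq> A \<and> measure M A \<le> measure M K + e"
  shows "regular_borel_measure M"
  unfolding regular_borel_measure_def
proof (intro conjI ballI M)
  interpret finite_measure M by fact
  note space_eq_UNIV[OF M, simp] M[simp]
  fix A :: "betaN set" assume A: "A \<in> sets borel"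
  show "emeasure M A = (SUP K\<in>{K. compact K \<and> closed K \<and> K \<subseteq> A}. emeasure M K)"
  proof (rule ennreal_approx_SUP)
    fix e :: real assume "e > 0"
    then obtain K where "closed K" "K \<subseteq> A" "measure M A \<le> measure M K + e"
      using inner[OF A] by blast
    then show "\<exists>K\<in>{K. compact K \<and> closed K \<and> K \<subseteq> A}. emeasure M A \<le> emeasure M K + ennreal e"
      using \<open>e > 0\<close>
      by (intro bexI[of _ K]) (auto simp: emeasure_eq_measure closed_imp_compact_betaN simp flip: ennreal_plus)
  qed (use A in \<open>auto intro: emeasure_mono\<close>)
  show "emeasure M A = (INF V\<in>{V. open V \<and> A \<subseteq> V}. emeasure M V)"
  proof (rule ennreal_approx_INF)
    fix e :: real assume "e > 0"
    moreover have "- A \<in> sets borel" using A by (simp add: borel_comp)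
    ultimately obtain K where K: "closed K" "K \<subseteq> - A" "measure M (- A) \<le> measure M K + e"
      using inner by blast
    have "measure M (- A) = measure M UNIV - measure M A" "measure M (- K) = measure M UNIV - measure M K"
      using A K finite_measure_compl[of A] finite_measure_compl[of K] by (auto simp: Compl_eq_Diff_UNIV)
    then have "measure M (- K) \<le> measure M A + e"
      using K by simp
    then show "\<exists>V\<in>{V. open V \<and> A \<subseteq> V}. emeasure M V \<le> emeasure M A + ennreal e"
      using \<open>e > 0\<close> K
      by (intro bexI[of _ "- K"]) (auto simp: emeasure_eq_measure simp flip: ennreal_plus)
  qed (use A in \<open>auto intro!: emeasure_mono\<close>)
qed

text \<open>Inner regularity in real-valued form. When \<open>A\<close> has measure at most
  \<open>e\<close> the empty set serves; this keeps \<open>measure M A - e\<close> positive before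
  it passes through \<open>ennreal\<close>, which truncates negative numbers.\<close>

lemma regular_borel_measure_inner:
  fixes M :: "betaN measure"
  assumes "finite_measure M" "regular_borel_measure M" "A \<in> sets borel" "(e::real) > 0"
  obtains K where "closed K" "compact K" "K \<subseteq> A" "measure M A \<le> measure M K + e"
proof (cases "measure M A \<le> e")
  case True
  then show ?thesis using that[of "{}"] by simp
next
  case False
  interpret finite_measure M by fact
  have "ennreal (measure M A - e) < ennreal (measure M A)"
    using False assms by (intro ennreal_lessI) auto
  also have "\<dots> = (SUP K\<in>{K. compact K \<and> closed K \<and> K \<subseteq> A}. emeasure M K)"
    using regular_inner[OF assms(2,3)] by (simp add: emeasure_eq_measure)
  finally obtain K where "compact K" "closed K" "K \<subseteq> A" "ennreal (measure M A - e) < emeasure M K"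
    unfolding less_SUP_iff by auto
  moreover from this(4) have "measure M A - e < measure M K"
    unfolding emeasure_eq_measure by (subst (asm) ennreal_less_iff) (use False in auto)
  ultimately show ?thesis
    using that[of K] by simp
qed

text \<open>By inner regularity and clopen separation the clopen sets determine the measure of open
  sets; outer regularity then determines it on all Borel sets.\<close>

lemma regular_borel_measure_eqI:
  fixes M N :: "betaN measure"
  assumes M: "regular_borel_measure M" and N: "regular_borel_measure N"
    and hat: "\<And>A. emeasure M (hat A) = emeasure N (hat A)"
  shows "M = N"
proof (rule measure_eqI)
  show sets: "sets M = sets N"
    using regular_sets[OF M] regular_sets[OF N] by simp
  \<comment> \<open>Stated for arbitrary \<open>M\<close> and \<open>N\<close> so that it can be
    used in both directions.\<close>
  have le: "emeasure M V \<le> emeasure N V"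
    if "regular_borel_measure M" "regular_borel_measure N" "open V"
      "\<And>A. emeasure M (hat A) = emeasure N (hat A)"
    for M N :: "betaN measure" and V
  proof -
    have "emeasure M V = (SUP K\<in>{K. compact K \<and> closed K \<and> K \<subseteq> V}. emeasure M K)"
      by (rule regular_inner[OF that(1)]) (use \<open>open V\<close> in auto)
    also have "\<dots> \<le> emeasure N V"
    proof (rule SUP_least)
      fix K assume "K \<in> {K. compact K \<and> closed K \<and> K \<subseteq> V}"
      then obtain A where A: "K \<subseteq> hat A" "hat A \<subseteq> V"
        using compact_open_separation \<open>open V\<close> by blast
      have "emeasure M K \<le> emeasure M (hat A)"
        using A regular_sets[OF that(1)] by (intro emeasure_mono) auto
      also have "\<dots> \<le> emeasure N V"
        unfolding that(4) using A regular_sets[OF that(2)] \<open>open V\<close> by (intro emeasure_mono) auto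
      finally show "emeasure M K \<le> emeasure N V" .
    qed
    finally show ?thesis .
  qed
  have eq: "emeasure M V = emeasure N V" if "open V" for V
    using le[OF M N that] le[OF N M that] hat by (auto intro: antisym)
  fix A assume "A \<in> sets M"
  then have "A \<in> sets borel"
    using regular_sets[OF M] by simp
  then have "emeasure M A = (INF V\<in>{V. open V \<and> A \<subseteq> V}. emeasure M V)"
    and "emeasure N A = (INF V\<in>{V. open V \<and> A \<subseteq> V}. emeasure N V)"
    using regular_outer[OF M] regular_outer[OF N] by blast+
  moreover have "(INF V\<in>{V. open V \<and> A \<subseteq> V}. emeasure M V) = (INF V\<in>{V. open V \<and> A \<subseteq> V}. emeasure N V)"
    using eq by (intro INF_cong) auto
  ultimately show "emeasure M A = emeasure N A" by simp
qed

text \<open>Outer approximation is built into \<open>outer_content\<close>; applied to the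
  complement of \<open>A\<close> it gives a closed set inside \<open>A\<close>.\<close>

lemma regular_content_measure: "regular_borel_measure (content_measure U)"
proof (rule regular_borel_measureI)
  interpret prob_space "content_measure U"
    by (rule prob_space_content_measure)
  show "finite_measure (content_measure U)" by (rule finite_measure_axioms)
  note [simp] = space_eq_UNIV[OF sets_content_measure]
  fix A :: "betaN set" and e :: real assume A: "A \<in> sets borel" and e: "e > 0"
  obtain V where V: "open V" "- A \<subseteq> V" "inner_content U V \<le> outer_content U (- A) + ennreal e"
    using outer_content_approx[OF e outer_content_finite] by blast
  have "- A \<in> sets borel" using A by (simp add: borel_comp)
  then have "emeasure (content_measure U) V \<le> emeasure (content_measure U) (- A) + ennreal e"
    using V by (simp add: emeasure_content_measure outer_content_open)
  then have "prob V \<le> prob (- A) + e"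
    using e by (simp add: emeasure_eq_measure flip: ennreal_plus)
  moreover have "prob (- A) = 1 - prob A" "prob (- V) = 1 - prob V"
    using A V prob_compl[of A] prob_compl[of V] by (auto simp: Compl_eq_Diff_UNIV)
  ultimately show "\<exists>K. closed K \<and> K \<subseteq> A \<and> prob A \<le> prob K + e"
    using V by (intro exI[of _ "- V"]) auto
qed simp

section \<open>Integrals of limits along ultrafilters\<close>

lemma integrable_plim:
  assumes "bounded (range b)" "finite_measure M" "sets M = sets borel"
  shows "integrable M (\<lambda>p. plim p b)"
proof -
  interpret finite_measure M by fact
  obtain C where C: "\<And>n. \<bar>b n\<bar> \<le> C"
    using assms by (auto simp: bounded_iff)
  have "\<bar>plim p b\<bar> \<le> C" for p
    using plim_diff_le[OF assms(1), of "\<lambda>_. 0" C p] C by simp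
  moreover have "(\<lambda>p. plim p b) \<in> borel_measurable M"
    using borel_measurable_continuous_onI[OF continuous_plim[OF assms(1)]] assms(3)
    by (simp cong: measurable_cong_sets)
  ultimately show ?thesis
    by (intro integrable_const_bound[of _ C]) auto
qed

text \<open>An ultrafilter contains \<open>A\<close> or its complement, so the indicator is
  eventually constant along it. This ties densities of sets to measures of clopen sets.\<close>

lemma plim_indicator: "plim p (indicator A) = indicator (hat A) p"
proof (rule plim_eqI)
  have "eventually (\<lambda>n. indicator A n = (indicator (hat A) p :: real)) (filter_of p)"
  proof (cases "p \<in> hat A")
    case True
    then show ?thesis by (auto simp: hat_def elim: eventually_mono)
  next
    case False
    then have "p \<in> hat (- A)" by (simp add: hat_Compl)
    with False show ?thesis by (auto simp: hat_def indicator_def elim: eventually_mono)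
  qed
  then show "(indicator A \<longlongrightarrow> (indicator (hat A) p :: real)) (filter_of p)"
    by (rule tendsto_eventually)
qed

lemma bounded_sum_indicator:
  fixes c :: "'i \<Rightarrow> real"
  shows "bounded (range (\<lambda>n::nat. \<Sum>i\<in>I. c i * indicator (A i) n))"
proof (rule boundedI)
  fix x assume "x \<in> range (\<lambda>n::nat. \<Sum>i\<in>I. c i * indicator (A i) n)"
  then obtain n where "x = (\<Sum>i\<in>I. c i * indicator (A i) n)" by auto
  also have "norm \<dots> \<le> (\<Sum>i\<in>I. \<bar>c i\<bar>)"
    by (intro sum_norm_le) (auto simp: indicator_def)
  finally show "norm x \<le> (\<Sum>i\<in>I. \<bar>c i\<bar>)" .
qed

text \<open>Both sides are linear in \<open>b\<close>, agree on indicators, and change by at most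
  the uniform distance of two sequences; every bounded sequence is a uniform limit of finitely
  valued ones.\<close>

lemma integral_plim:
  assumes M: "prob_space M" "sets M = sets borel"
    and hat: "\<And>A. measure M (hat A) = dens U A"
    and b: "bounded (range b)"
  shows "(\<integral>p. plim p b \<partial>M) = mean U b"
proof -
  interpret prob_space M by fact
  note integrable = integrable_plim[OF _ finite_measure_axioms M(2)]
  have simple: "(\<integral>p. plim p (\<lambda>n. \<Sum>i\<in>I. c i * indicator (A i) n) \<partial>M)
      = mean U (\<lambda>n. \<Sum>i\<in>I. c i * indicator (A i) n)"
    if "finite I" for I :: "real set" and c A
    using that
  proof (induction I rule: finite_induct)
    case empty
    then show ?case by (simp add: mean_def)
  next
    case (insert i I)
    let ?s = "\<lambda>n. \<Sum>i\<in>I. c i * indicator (A i) n" and ?t = "\<lambda>n. c i * indicator (A i) n"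
    have bd: "bounded (range ?t)" "bounded (range ?s)"
      by (intro bounded_range_cmult bounded_indicator bounded_sum_indicator)+
    have "(\<integral>p. plim p (\<lambda>n. ?t n + ?s n) \<partial>M) = (\<integral>p. plim p ?t + plim p ?s \<partial>M)"
      by (simp add: plim_add[OF bd])
    also have "\<dots> = (\<integral>p. plim p ?t \<partial>M) + (\<integral>p. plim p ?s \<partial>M)"
      by (intro Bochner_Integration.integral_add integrable bd)
    also have "(\<integral>p. plim p ?t \<partial>M) = mean U ?t"
      using M(2)
      by (simp add: plim_cmult mean_cmult bounded_indicator plim_indicator hat dens_def[symmetric] space_eq_UNIV)
    also have "(\<integral>p. plim p ?s \<partial>M) = mean U ?s" by (rule insert.IH)
    finally show ?case
      unfolding sum.insert[OF insert.hyps] mean_add[OF bd] .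
  qed
  have "\<bar>(\<integral>p. plim p b \<partial>M) - mean U b\<bar> \<le> 0 + e" if "e > 0" for e
  proof -
    \<comment> \<open>The approximation error enters twice, once in the integral and once in the
      mean.\<close>
    define d where "d = e / 2"
    have d: "d > 0" using that by (simp add: d_def)
    obtain C where C: "\<And>n. \<bar>b n\<bar> \<le> C"
      using b by (auto simp: bounded_iff)
    \<comment> \<open>Rounding \<open>b\<close> down to multiples of \<open>d\<close> gives finitely
      many values because \<open>b\<close> is bounded.\<close>
    define s where "s n = d * real_of_int \<lfloor>b n / d\<rfloor>" for n
    have "range s \<subseteq> (\<lambda>k. d * real_of_int k) ` {\<lfloor>- C / d\<rfloor>..\<lfloor>C / d\<rfloor>}"
    proof
      fix x assume "x \<in> range s"
      then obtain n where n: "x = d * real_of_int \<lfloor>b n / d\<rfloor>" by (auto simp: s_def)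
      have "- C \<le> b n" "b n \<le> C" using C[of n] by linarith+
      then have "- C / d \<le> b n / d" "b n / d \<le> C / d"
        using d by (simp_all add: field_simps)
      then have "\<lfloor>b n / d\<rfloor> \<in> {\<lfloor>- C / d\<rfloor>..\<lfloor>C / d\<rfloor>}"
        by (auto intro: floor_mono)
      with n show "x \<in> (\<lambda>k. d * real_of_int k) ` {\<lfloor>- C / d\<rfloor>..\<lfloor>C / d\<rfloor>}"
        by blast
    qed
    then have fin: "finite (range s)"
      by (rule finite_subset) auto
    then have s_bd: "bounded (range s)" by (rule finite_imp_bounded)
    have s_eq: "s = (\<lambda>n. \<Sum>v\<in>range s. v * indicator (s -` {v}) n)"
    proof
      fix n
      have "(\<Sum>v\<in>range s. v * indicator (s -` {v}) n) = (\<Sum>v\<in>range s. if v = s n then v else 0)"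
        by (intro sum.cong) (auto simp: indicator_def)
      then show "s n = (\<Sum>v\<in>range s. v * indicator (s -` {v}) n)"
        using fin by simp
    qed
    have close: "\<bar>b n - s n\<bar> \<le> d" for n
    proof -
      have "real_of_int \<lfloor>b n / d\<rfloor> * d \<le> b n"
        unfolding pos_le_divide_eq[OF d, symmetric] by linarith
      moreover have "b n \<le> (real_of_int \<lfloor>b n / d\<rfloor> + 1) * d"
        unfolding pos_divide_le_eq[OF d, symmetric] by linarith
      ultimately show ?thesis
        by (simp add: s_def abs_le_iff algebra_simps)
    qed
    have "\<bar>(\<integral>p. plim p b \<partial>M) - (\<integral>p. plim p s \<partial>M)\<bar> = \<bar>\<integral>p. plim p b - plim p s \<partial>M\<bar>"
      by (simp add: integrable b s_bd)
    also have "\<dots> \<le> (\<integral>p. \<bar>plim p b - plim p s\<bar> \<partial>M)"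
      by (rule integral_abs_bound)
    also have "\<dots> \<le> (\<integral>p. d \<partial>M)"
      by (intro integral_mono integrable_abs Bochner_Integration.integrable_diff integrable b s_bd plim_diff_le close) auto
    also have "\<dots> = d" using prob_space by simp
    finally have "\<bar>(\<integral>p. plim p b \<partial>M) - (\<integral>p. plim p s \<partial>M)\<bar> \<le> d" .
    moreover have "\<bar>mean U b - mean U s\<bar> \<le> d"
      by (rule mean_diff_le[OF b s_bd close])
    moreover have "(\<integral>p. plim p s \<partial>M) = mean U s"
      using simple[OF fin, of "\<lambda>v. v" "\<lambda>v. s -` {v}"] unfolding s_eq[symmetric] .
    ultimately show ?thesis unfolding d_def by linarith
  qed
  then have "\<bar>(\<integral>p. plim p b \<partial>M) - mean U b\<bar> \<le> 0"
    by (rule field_le_epsilon)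
  then show ?thesis by simp
qed

section \<open>Identification of the representing measure\<close>

lemma cesaro_functional_eq_mean:
  assumes "continuous_on UNIV \<psi>"
  shows "cesaro_functional U \<psi> = mean U (\<lambda>n. \<psi> (pt n))"
proof -
  have "cesaro_functional U \<psi> = mean U (sequence_of \<psi>)"
    by (simp add: cesaro_functional_def mean_def)
  also have "\<dots> = mean U (\<lambda>n. \<psi> (pt n))"
    using sequence_of_eq[OF assms] by (intro mean_cong) auto
  finally show ?thesis .
qed

text \<open>Riesz representation made explicit, which resolves the definite description. Existence
  is \<open>integral_plim\<close>; for uniqueness, indicators of clopen sets are continuous and so
  test any competing measure on every \<open>hat A\<close>.\<close>

lemma eta_eq_content_measure: "eta U = content_measure U"
  unfolding eta_def
proof (rule the_equality, intro conjI allI impI)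
  show ps: "prob_space (content_measure U)"
    by (rule prob_space_content_measure)
  show "regular_borel_measure (content_measure U)"
    by (rule regular_content_measure)
  fix \<psi> :: "betaN \<Rightarrow> real" assume \<psi>: "continuous_on UNIV \<psi>"
  have "(\<integral>p. plim p (\<lambda>n. \<psi> (pt n)) \<partial>content_measure U) = mean U (\<lambda>n. \<psi> (pt n))"
    using continuous_eq_plim(1)[OF \<psi>]
    by (intro integral_plim ps) (auto simp: measure_def emeasure_content_measure_hat dens_nonneg)
  then show "cesaro_functional U \<psi> = (\<integral>p. \<psi> p \<partial>content_measure U)"
    by (simp add: cesaro_functional_eq_mean[OF \<psi>] flip: continuous_eq_plim(2)[OF \<psi>])
next
  fix M
  assume M: "prob_space M \<and> regular_borel_measure M \<and>
     (\<forall>\<psi>. continuous_on UNIV \<psi> \<longrightarrow> cesaro_functional U \<psi> = (\<integral>p. \<psi> p \<partial>M))"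
  then interpret prob_space M by simp
  have sets: "sets M = sets borel" using M regular_sets by blast
  have "emeasure M (hat A) = ennreal (dens U A)" for A
  proof -
    have c: "continuous_on UNIV (indicator (hat A) :: betaN \<Rightarrow> real)"
      using continuous_plim[OF bounded_indicator[of A]] by (simp add: plim_indicator)
    have "measure M (hat A) = cesaro_functional U (indicator (hat A))"
      using M c sets by (simp add: space_eq_UNIV)
    also have "\<dots> = dens U A"
      unfolding cesaro_functional_eq_mean[OF c] dens_def
      by (rule mean_cong) (simp add: indicator_def pt_in_hat)
    finally show ?thesis by (simp add: emeasure_eq_measure)
  qed
  then show "M = content_measure U"
    using M by (intro regular_borel_measure_eqI regular_content_measure) (auto simp: emeasure_content_measure_hat)
qed

section \<open>Invariance and the principal points\<close>

lemma
  shows prob_space_eta: "prob_space (eta U)"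
    and regular_eta: "regular_borel_measure (eta U)"
    and sets_eta [simp]: "sets (eta U) = sets borel"
    and space_eta [simp]: "space (eta U) = UNIV"
    and emeasure_eta_hat: "emeasure (eta U) (hat A) = ennreal (dens U A)"
  unfolding eta_eq_content_measure
  by (simp_all add: prob_space_content_measure regular_content_measure space_eq_UNIV emeasure_content_measure_hat)

text \<open>An ultrafilter avoiding all singletons avoids all finite sets, so it contains every
  cofinite set.\<close>

lemma not_principal_le_sequentially:
  assumes "\<And>n. 1 \<le> n \<Longrightarrow> p \<notin> hat {n}"
  shows "filter_of p \<le> sequentially"
proof (rule filter_leI)
  fix P :: "nat \<Rightarrow> bool" assume "eventually P sequentially"
  then obtain N where N: "\<And>n. N \<le> n \<Longrightarrow> P n"
    by (auto simp: eventually_sequentially)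
  have "eventually (\<lambda>m. m \<noteq> n) (filter_of p)" for n
  proof (cases "1 \<le> n")
    case True
    then show ?thesis using assms[of n] by (simp add: hat_def ultra_not_iff)
  next
    case False
    then show ?thesis using filter_of_ge_1[of p] by (auto elim: eventually_mono)
  qed
  then have "eventually (\<lambda>m. \<forall>n\<in>{..<N}. m \<noteq> n) (filter_of p)"
    by (intro eventually_ball_finite) auto
  then show "eventually P (filter_of p)"
    by (rule eventually_mono) (use N in \<open>auto simp: not_less[symmetric]\<close>)
qed

lemma nonprincipal_le_sequentially:
  assumes "nonprincipal p"
  shows "filter_of p \<le> sequentially"
  using assms by (intro not_principal_le_sequentially) (auto simp: nonprincipal_def hat_singleton filter_of_pt)

text \<open>Bounded partial sums divided by \<open>n\<close> tend to 0, and a nonprincipal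
  ultrafilter inherits ordinary limits.\<close>

lemma mean_eq_0:
  assumes "nonprincipal U" "\<And>n. \<bar>\<Sum>k = 1..n. b k\<bar> \<le> C"
  shows "mean U b = 0"
  unfolding mean_def
proof (rule plim_eqI)
  have "(\<lambda>n. (\<Sum>k = 1..n. b k) / real n) \<longlonglongrightarrow> 0"
  proof (rule tendsto_0_le[OF lim_const_over_n[of C], of _ 1], rule always_eventually, rule allI)
    fix n show "norm ((\<Sum>k = 1..n. b k) / real n) \<le> norm (C / real n) * 1"
      using assms(2)[of n] by (auto simp: intro!: divide_right_mono)
  qed
  then show "((\<lambda>n. (\<Sum>k = 1..n. b k) / real n) \<longlongrightarrow> 0) (filter_of U)"
    by (rule tendsto_mono[OF nonprincipal_le_sequentially[OF assms(1)]])
qed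

lemma dens_singleton:
  assumes "nonprincipal U"
  shows "dens U {n} = 0"
  unfolding dens_def
proof (rule mean_eq_0[OF assms])
  fix m
  have "(\<Sum>k = 1..m. indicator {n} k :: real) = (\<Sum>k = 1..m. if k = n then 1 else 0)"
    by (intro sum.cong) auto
  then show "\<bar>\<Sum>k = 1..m. indicator {n} k :: real\<bar> \<le> 1"
    by simp
qed

lemma dens_Suc_vimage:
  assumes "nonprincipal U"
  shows "dens U (Suc -` A) = dens U A"
proof -
  let ?i = "indicator A :: nat \<Rightarrow> real"
  have "mean U (\<lambda>k. ?i (Suc k) + - 1 * ?i k) = 0"
  proof (rule mean_eq_0[OF assms])
    fix n
    \<comment> \<open>The sum telescopes, so the partial sums stay bounded while \<open>n\<close>
      grows.\<close>
    have "(\<Sum>k = 1..n. ?i (Suc k) + - 1 * ?i k) = ?i (Suc n) - ?i 1"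
      by (induction n) auto
    then show "\<bar>\<Sum>k = 1..n. ?i (Suc k) + - 1 * ?i k\<bar> \<le> 1"
      by (auto simp: indicator_def)
  qed
  moreover have "?i (Suc k) = indicator (Suc -` A) k" for k
    by (simp add: indicator_def)
  ultimately show ?thesis
    using mean_add[OF bounded_indicator[of "Suc -` A"] bounded_range_cmult[OF bounded_indicator[of A]], of U "- 1"]
      mean_cmult[OF bounded_indicator, of U "- 1" A]
    by (simp add: dens_def)
qed

lemma measurable_betaN_shift: "betaN_shift \<in> measurable (eta U) (eta U)"
  using borel_measurable_continuous_onI[OF continuous_betaN_shift]
  by (simp cong: measurable_cong_sets)

text \<open>A compact \<open>K\<close> inside the preimage of \<open>A\<close> has a compact, hence
  closed, image inside \<open>A\<close>, and the preimage of that image contains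
  \<open>K\<close>.\<close>

lemma regular_distr_betaN_shift:
  assumes "finite_measure M" "regular_borel_measure M"
  shows "regular_borel_measure (distr M borel betaN_shift)"
proof (rule regular_borel_measureI)
  interpret finite_measure M by fact
  have [simp]: "sets M = sets borel" "space M = UNIV"
    using regular_sets[OF assms(2)] space_eq_UNIV by auto
  have meas: "betaN_shift \<in> measurable M borel"
    using borel_measurable_continuous_onI[OF continuous_betaN_shift]
    by (simp cong: measurable_cong_sets)
  show "finite_measure (distr M borel betaN_shift)"
    by (rule finite_measure_distr[OF meas])
  fix A :: "betaN set" and e :: real assume A: "A \<in> sets borel" and e: "e > 0"
  have "betaN_shift -` A \<in> sets borel"
    using measurable_sets[OF meas, of A] A by simp
  then obtain K where K: "compact K" "K \<subseteq> betaN_shift -` A"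
    "measure M (betaN_shift -` A) \<le> measure M K + e"
    using regular_borel_measure_inner[OF assms _ e] by metis
  have cl: "closed (betaN_shift ` K)"
    using K continuous_betaN_shift
    by (intro compact_imp_closed compact_continuous_image continuous_on_subset[OF continuous_betaN_shift]) auto
  have "betaN_shift -` (betaN_shift ` K) \<in> sets M"
    using measurable_sets[OF meas, of "betaN_shift ` K"] cl by simp
  then have "measure M K \<le> measure M (betaN_shift -` (betaN_shift ` K))"
    by (intro finite_measure_mono) auto
  then show "\<exists>K. closed K \<and> K \<subseteq> A \<and>
      measure (distr M borel betaN_shift) A \<le> measure (distr M borel betaN_shift) K + e"
    using K cl A by (intro exI[of _ "betaN_shift ` K"]) (auto simp: measure_distr[OF meas])
qed simp

lemma invariant_eta:
  assumes "nonprincipal U"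
  shows "invariant_measure betaN_shift (eta U)"
  unfolding invariant_measure_def
proof
  interpret prob_space "eta U" by (rule prob_space_eta)
  have "distr (eta U) borel betaN_shift = eta U"
  proof (rule regular_borel_measure_eqI)
    show "regular_borel_measure (distr (eta U) borel betaN_shift)"
      by (rule regular_distr_betaN_shift[OF finite_measure_axioms regular_eta])
    show "regular_borel_measure (eta U)"
      by (rule regular_eta)
    show "emeasure (distr (eta U) borel betaN_shift) (hat A) = emeasure (eta U) (hat A)" for A
      using measurable_betaN_shift[of U]
      by (subst emeasure_distr)
        (auto simp: vimage_betaN_shift_hat emeasure_eta_hat dens_Suc_vimage[OF assms] cong: measurable_cong_sets)
  qed
  then show "distr (eta U) (eta U) betaN_shift = eta U"
    by (metis distr_cong sets_eta)
qed (rule measurable_betaN_shift)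

text \<open>Each singleton has density 0, so the principal points form a countable union of null
  sets.\<close>

lemma AE_eta_le_sequentially:
  assumes "nonprincipal U"
  shows "AE p in eta U. filter_of p \<le> sequentially"
proof -
  have "AE p in eta U. p \<notin> hat {n}" for n
    by (rule AE_not_in) (simp add: null_sets_def emeasure_eta_hat dens_singleton[OF assms])
  then have "AE p in eta U. \<forall>n. p \<notin> hat {n}"
    by (simp add: AE_all_countable)
  then show ?thesis
    by eventually_elim (rule not_principal_le_sequentially, blast)
qed

section \<open>Slowly varying sequences\<close>

lemma plim_betaN_shift: "plim (betaN_shift p) b = plim p (\<lambda>m. b (Suc m))"
  by (simp add: plim_def Topological_Spaces.Lim_def filter_of_betaN_shift filterlim_filtermap)

lemma plim_betaN_shift_funpow: "plim ((betaN_shift ^^ k) p) b = plim p (\<lambda>m. b (m + k))"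
  \<comment> \<open>The outermost shift moves into the sequence first, so the induction hypothesis
    is needed for a shifted \<open>b\<close>.\<close>
  by (induction k arbitrary: b) (simp_all add: plim_betaN_shift)

text \<open>The \<open>k\<close>-step differences are sums of \<open>k\<close> one-step differences
  and tend to 0, also along the finer filter \<open>p\<close>.\<close>

lemma plim_shift_eq:
  assumes b: "bounded (range b)" and lim: "(\<lambda>m. b (Suc m) - b m) \<longlonglongrightarrow> 0"
    and p: "filter_of p \<le> sequentially"
  shows "plim p (\<lambda>m. b (m + k)) = plim p b"
proof (rule plim_eqI)
  have "(\<lambda>m. b (m + k) - b m) \<longlonglongrightarrow> 0"
  proof (induction k)
    case (Suc k)
    have "(\<lambda>m. (b (Suc (m + k)) - b (m + k)) + (b (m + k) - b m)) \<longlonglongrightarrow> 0 + 0"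
      by (rule tendsto_add[OF LIMSEQ_ignore_initial_segment[OF lim, of k] Suc])
    then show ?case by simp
  qed simp
  then have "((\<lambda>m. (b (m + k) - b m) + b m) \<longlongrightarrow> 0 + plim p b) (filter_of p)"
    by (intro tendsto_add tendsto_plim[OF b] tendsto_mono[OF p])
  then show "((\<lambda>m. b (m + k)) \<longlongrightarrow> plim p b) (filter_of p)" by simp
qed

section \<open>Birkhoff averages along the orbit and the conclusion\<close>

lemma birkhoff_average_bounded:
  assumes "\<And>k. \<bar>\<phi> ((T ^^ k) x)\<bar> \<le> C"
  shows "\<bar>birkhoff_average T \<phi> x m\<bar> \<le> C"
proof (cases "m = 0")
  case True
  then show ?thesis using assms[of 0] by (simp add: birkhoff_average_def)
next
  case False
  have "\<bar>\<Sum>k<m. \<phi> ((T ^^ k) x)\<bar> \<le> (\<Sum>k<m. C)"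
    by (rule order_trans[OF sum_abs sum_mono]) (rule assms)
  then show ?thesis
    using False by (simp add: birkhoff_average_def field_simps)
qed

text \<open>With \<open>a\<close> the averages, \<open>(m + 1) * (a (m + 1) - a m)\<close> equals
  \<open>\<phi> ((T ^^ m) x) - a m\<close>, which is bounded by \<open>2 * C\<close>.\<close>

lemma birkhoff_average_slowly_varying:
  assumes C: "\<And>k. \<bar>\<phi> ((T ^^ k) x)\<bar> \<le> C"
  shows "(\<lambda>m. birkhoff_average T \<phi> x (Suc m) - birkhoff_average T \<phi> x m) \<longlonglongrightarrow> 0"
proof (rule tendsto_0_le)
  show "(\<lambda>m. 2 * C / real (Suc m)) \<longlonglongrightarrow> 0"
    using LIMSEQ_Suc[OF lim_const_over_n[of "2 * C"]] by simp
  have "\<bar>birkhoff_average T \<phi> x (Suc m) - birkhoff_average T \<phi> x m\<bar> \<le> 2 * C / real (Suc m)" for m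
  proof -
    let ?a = "birkhoff_average T \<phi> x"
    have "real (Suc m) * ?a (Suc m) = (\<Sum>k<m. \<phi> ((T ^^ k) x)) + \<phi> ((T ^^ m) x)"
      by (simp add: birkhoff_average_def)
    also have "(\<Sum>k<m. \<phi> ((T ^^ k) x)) = real m * ?a m"
      by (cases "m = 0") (simp_all add: birkhoff_average_def)
    finally have "real (Suc m) * (?a (Suc m) - ?a m) = \<phi> ((T ^^ m) x) - ?a m"
      by (simp add: algebra_simps)
    then have "real (Suc m) * \<bar>?a (Suc m) - ?a m\<bar> = \<bar>\<phi> ((T ^^ m) x) - ?a m\<bar>"
      by (metis abs_mult abs_of_nat)
    also have "\<dots> \<le> 2 * C"
      using C[of m] birkhoff_average_bounded[of \<phi> T x C m, OF C] by linarith
    finally show ?thesis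
      by (simp add: pos_le_divide_eq mult.commute)
  qed
  then show "eventually (\<lambda>m. norm (birkhoff_average T \<phi> x (Suc m) - birkhoff_average T \<phi> x m)
      \<le> norm (2 * C / real (Suc m)) * 1) sequentially"
    by (intro always_eventually allI) (metis abs_ge_self mult.right_neutral order_trans real_norm_def)
qed

text \<open>Integrability and convergence are asserted explicitly because the integral of a
  non-integrable function is 0 and \<open>lim\<close> is a total function.\<close>

theorem mainTheorem4:
  fixes X :: "'a::metric_space set"
    and T :: "'a \<Rightarrow> 'a"
    and \<phi> :: "'a \<Rightarrow> real"
    and U :: betaN
  assumes "compact X"
    and "T \<in> measurable (restrict_space borel X) (restrict_space borel X)"
    and "bounded (\<phi> ` X)"
    and "nonprincipal U"
  shows "prob_space (eta U) \<and> sets (eta U) = sets borel \<and> invariant_measure betaN_shift (eta U) \<and>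
    (\<forall>x0\<in>X.
      let a = (\<lambda>m. birkhoff_average T \<phi> x0 m);
          \<psi> = (\<lambda>p. plim p a);
          \<psi>' = birkhoff_limit betaN_shift \<psi>
      in integrable (eta U) \<psi> \<and>
         (AE p in eta U.
            birkhoff_average betaN_shift \<psi> p \<longlonglongrightarrow> \<psi>' p \<and>
            (\<lambda>n. (\<Sum>k<n. plim p (\<lambda>m. a (m + k))) / real n) \<longlonglongrightarrow> \<psi>' p) \<and>
         integrable (eta U) \<psi>' \<and>
         (\<integral>p. \<psi> p \<partial>eta U) = (\<integral>p. \<psi>' p \<partial>eta U))"
proof (intro conjI ballI)
  show ps: "prob_space (eta U)" by (rule prob_space_eta)
  show "sets (eta U) = sets borel" by simp
  show "invariant_measure betaN_shift (eta U)" by (rule invariant_eta) fact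
  interpret prob_space "eta U" by (rule ps)
  fix x0 assume x0: "x0 \<in> X"
  define a where "a = (\<lambda>m. birkhoff_average T \<phi> x0 m)"
  define \<psi> where "\<psi> = (\<lambda>p. plim p a)"
  define \<psi>' where "\<psi>' = birkhoff_limit betaN_shift \<psi>"
  \<comment> \<open>Measurability between the restricted spaces includes that \<open>T\<close> maps
    \<open>X\<close> to itself, so the orbit stays where \<open>\<phi>\<close> is bounded.\<close>
  have "T y \<in> X" if "y \<in> X" for y
    using measurable_space[OF assms(2)] that by (simp add: space_restrict_space)
  then have "(T ^^ k) x0 \<in> X" for k
    using x0 by (induction k) auto
  moreover obtain C where "\<And>y. y \<in> X \<Longrightarrow> \<bar>\<phi> y\<bar> \<le> C"
    using assms(3) by (auto simp: bounded_iff)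
  ultimately have C: "\<And>k. \<bar>\<phi> ((T ^^ k) x0)\<bar> \<le> C" by blast
  have a_bd: "bounded (range a)"
    unfolding a_def using birkhoff_average_bounded[of \<phi> T x0 C, OF C] by (auto simp: bounded_iff)
  have a_slow: "(\<lambda>m. a (Suc m) - a m) \<longlonglongrightarrow> 0"
    unfolding a_def by (rule birkhoff_average_slowly_varying[of \<phi> T x0 C, OF C])
  have avg: "birkhoff_average betaN_shift \<psi> p = (\<lambda>n. (\<Sum>k<n. plim p (\<lambda>m. a (m + k))) / real n)" for p
    by (simp add: birkhoff_average_def \<psi>_def plim_betaN_shift_funpow fun_eq_iff)
  have int: "integrable (eta U) \<psi>"
    unfolding \<psi>_def by (rule integrable_plim[OF a_bd finite_measure_axioms]) simp
  have ae: "AE p in eta U. birkhoff_average betaN_shift \<psi> p \<longlonglongrightarrow> \<psi> p"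
    using AE_eta_le_sequentially[OF assms(4)]
  proof eventually_elim
    case (elim p)
    have "eventually (\<lambda>n. birkhoff_average betaN_shift \<psi> p n = \<psi> p) sequentially"
      \<comment> \<open>At \<open>n = 0\<close> the average is 0 by division by zero; for positive
        \<open>n\<close> all summands equal \<open>\<psi> p\<close>.\<close>
      using eventually_gt_at_top[of 0]
    proof eventually_elim
      case (elim n)
      then show ?case
        unfolding avg unfolding \<psi>_def
        by (simp add: plim_shift_eq[OF a_bd a_slow \<open>filter_of p \<le> sequentially\<close>])
    qed
    then show ?case by (rule tendsto_eventually)
  qed
  then have eq: "AE p in eta U. \<psi>' p = \<psi> p"
    by eventually_elim (simp add: \<psi>'_def birkhoff_limit_def limI)
  have meas: "\<psi> \<in> borel_measurable (eta U)"
    using int by (rule borel_measurable_integrable)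
  \<comment> \<open>The almost everywhere congruence rules ask for Borel measurability of
    \<open>\<psi>'\<close> on the whole space, including the null set where convergence is not
    established.\<close>
  have "birkhoff_average betaN_shift \<psi> = (\<lambda>p n. (\<Sum>k<n. \<psi> ((betaN_shift ^^ k) p)) / real n)"
    by (simp add: birkhoff_average_def fun_eq_iff)
  moreover have "betaN_shift ^^ k \<in> measurable (eta U) (eta U)" for k
    by (rule measurable_compose_n[OF measurable_betaN_shift])
  then have "(\<lambda>p. \<psi> ((betaN_shift ^^ k) p)) \<in> borel_measurable (eta U)" for k
    by (rule measurable_compose[OF _ meas])
  ultimately have meas': "\<psi>' \<in> borel_measurable (eta U)"
    unfolding \<psi>'_def birkhoff_limit_def
    by (auto intro!: borel_measurable_lim_metric borel_measurable_divide borel_measurable_sum)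
  have "integrable (eta U) \<psi>'"
    using int meas' meas eq by (subst integrable_cong_AE[OF meas' meas eq])
  moreover have "(\<integral>p. \<psi> p \<partial>eta U) = (\<integral>p. \<psi>' p \<partial>eta U)"
    using integral_cong_AE[OF meas' meas eq] by simp
  moreover have "AE p in eta U. birkhoff_average betaN_shift \<psi> p \<longlonglongrightarrow> \<psi>' p \<and>
      (\<lambda>n. (\<Sum>k<n. plim p (\<lambda>m. a (m + k))) / real n) \<longlonglongrightarrow> \<psi>' p"
    using ae eq by eventually_elim (simp flip: avg)
  ultimately have "integrable (eta U) \<psi> \<and>
      (AE p in eta U. birkhoff_average betaN_shift \<psi> p \<longlonglongrightarrow> \<psi>' p \<and>
        (\<lambda>n. (\<Sum>k<n. plim p (\<lambda>m. a (m + k))) / real n) \<longlonglongrightarrow> \<psi>' p) \<and>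
      integrable (eta U) \<psi>' \<and> (\<integral>p. \<psi> p \<partial>eta U) = (\<integral>p. \<psi>' p \<partial>eta U)"
    using int by blast
  then show "let a = (\<lambda>m. birkhoff_average T \<phi> x0 m);
          \<psi> = (\<lambda>p. plim p a);
          \<psi>' = birkhoff_limit betaN_shift \<psi>
      in integrable (eta U) \<psi> \<and>
         (AE p in eta U.
            birkhoff_average betaN_shift \<psi> p \<longlonglongrightarrow> \<psi>' p \<and>
            (\<lambda>n. (\<Sum>k<n. plim p (\<lambda>m. a (m + k))) / real n) \<longlonglongrightarrow> \<psi>' p) \<and>
         integrable (eta U) \<psi>' \<and>
         (\<integral>p. \<psi> p \<partial>eta U) = (\<integral>p. \<psi>' p \<partial>eta U)"
    unfolding Let_def \<psi>'_def \<psi>_def a_def .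
qed

end
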